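(* Let $l_1,l_2,l_3,l_4,h_1,h_2,h_3$ be nonzero complex numbers with $l_1l_2l_3l_4=h_1h_2h_3q^2$, let $E\in\mathbb C$, and suppose $g(x)$ satisfies the $q$-Heun equation $$(x-h_1q^{1/2})(x-h_2q^{1/2})g(x/q)+l_3l_4(x-l_1q^{-1/2})(x-l_2q^{-1/2})g(qx)-\big\{(l_3+l_4)x^2+l_3l_4Ex+(l_1l_2l_3l_4h_1h_2)^{1/2}(h_3^{1/2}+h_3^{-1/2})\big\}g(x)=0.$$ Let $\lambda$ satisfy $q^\lambda=q/l_4$ and let $\xi\in\mathbb C\setminus\{0\}$. Then the function $$\check g(x)=\int_0^{\xi\infty}\frac{g(s)}{s-x}P_\lambda(x,s)\,d_qs$$ formally (in the sense explained in the context) satisfies $$(x-h_1'q^{1/2})(x-h_2'q^{1/2})\check g(x/q)+l_3'l_4'(x-l_1'q^{-1/2})(x-l_2'q^{-1/2})\check g(qx)-\big\{(l_3'+l_4')x^2+l_3'l_4'Ex+(l_1'l_2'l_3'l_4'h_1'h_2')^{1/2}((h_3')^{1/2}+(h_3')^{-1/2})\big\}\check g(x)=0,$$ where $$l_1'=l_1,\quad l_2'=l_2,\quad l_3'=l_3,\quad l_4'=q,\quad h_1'=qh_1/l_4,\quad h_2'=qh_2/l_4,\quad h_3'=l_4/(qh_3).$$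
   Context: $q\in\mathbb C$, $0<|q|<1$, with a fixed square root $q^{1/2}$; parameters are generic so that all denominators below are nonzero. Jackson integral: $\int_0^{\xi\infty}f(s)\,d_qs=(1-q)\sum_{n=-\infty}^\infty q^n\xi f(q^n\xi)$. Kernel: $P_\lambda(x,s)=\prod_{i=0}^\infty\frac{x-q^{i+\lambda+1}s}{x-q^{i+1}s}$. Square roots: the branches are chosen compatibly, so that (as for positive real parameters) $(l_1l_2l_3l_4h_1h_2)^{1/2}h_3^{1/2}=qh_1h_2h_3$ and $h_3^{1/2}h_3^{-1/2}=1$, i.e. the constant term in braces in the first equation equals $qh_1h_2(1+h_3)$; similarly $(l_1'l_2'l_3'l_4'h_1'h_2')^{1/2}(h_3')^{1/2}=l_1l_2l_3/h_3$ and $(h_3')^{1/2}(h_3')^{-1/2}=1$, i.e. the constant term in braces in the second equation equals $l_1l_2l_3\,(q/l_4+1/h_3)$. Meaning of "formally". The result is stated under the following standing assumption on the Jackson integrals. Put $t=1$, $w=1$, $\theta_1=1$, $\theta_2=1/h_3$, $a_1=l_1q^{-1/2}$, $a_2=l_2q^{-1/2}$, $a_3=h_1q^{1/2}$, $a_4=h_2q^{-1/2}$, $\chi_1=1/(l_3a_1a_2)$, $\chi_2=q/(l_4a_1a_2)$ (so $\chi_1\chi_2a_1a_2a_3a_4=\theta_1\theta_2$ and $q^\lambda=\chi_2ta_1a_2/\theta_1$), and $$y=a_3,\qquad z=\frac{(ta_1-a_3)(ta_2-a_3)}{qt(\theta_1+\theta_2)+a_3^2(q\chi_1+\chi_2)+Eq\theta_1a_3/(ta_1a_2)}.$$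 Define $B_\infty=\frac{ta_1a_2}{\theta_1}\mathrm{diag}(\chi_1,\chi_2)$, $$B_1=\frac{a_2}{t\theta_1(a_1-a_2)}\begin{pmatrix}\dfrac{(y-ta_1)b_1^{[1]}}{qyz(\chi_1-\chi_2)}&w\chi_2(y-ta_1)\\[2mm] -\dfrac{b_1^{[1]}b_2^{[1]}}{q^2wy^2z^2(\chi_1-\chi_2)^2}&-\dfrac{\chi_2b_2^{[1]}}{qyz(\chi_1-\chi_2)}\end{pmatrix},$$ $b_1^{[1]}=q^2\chi_1^2\chi_2(y-a_3)(y-a_4)z^2+(y-ta_2)(\chi_2y-\chi_1ta_1)-q\chi_1\{2\chi_2y^2-(\chi_1ta_1+\chi_2ta_2+\chi_2a_3+\chi_2a_4)y+t(\theta_1+\theta_2)\}z$, $b_2^{[1]}=q^2\chi_1(y-a_3)(y-a_4)(\chi_1y-\chi_2ta_1)z^2+(y-ta_1)^2(y-ta_2)-q(y-ta_1)\{2\chi_1y^2-(\chi_2ta_1+\chi_1ta_2+\chi_1a_3+\chi_1a_4)y+t(\theta_1+\theta_2)\}z$, $B_2=B_1|_{a_1\leftrightarrow a_2}$ (with $y,z$ and all other parameters unchanged), $B_0=I_2-B_\infty-B_1-B_2$, and $B(x)=B_\infty+\frac{B_1}{1-x/(ta_1)}+\frac{B_2}{1-x/(ta_2)}=(b_{ij}(x))$. Put $y_1=g$, define $y_2$ by $y_1(qx)=b_{11}(x)y_1(x)+b_{12}(x)y_2(x)$, and let $Y={}^t(y_1,y_2)$. With $b_0=0,b_1=ta_1,b_2=ta_2$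 let $\widehat Y_i(x)=\int_0^{\xi\infty}\frac{P_\lambda(x,s)}{s-b_i}Y(s)\,d_qs$ ($i=0,1,2$) and $\widehat Y={}^t(\widehat Y_0,\widehat Y_1,\widehat Y_2)$. It is assumed that all Jackson integrals involved are well defined and converge absolutely, and that $\widehat Y(qx)=\big(F_\infty+\frac{F_1}{1-x/(ta_1)}+\frac{F_2}{1-x/(ta_2)}\big)\widehat Y(x)$, where in $2\times2$ blocks $$F_1=\begin{pmatrix}O&O&O\\ B_0&B_1-(1-q^\lambda)I_2&B_2\\ O&O&O\end{pmatrix},\quad F_2=\begin{pmatrix}O&O&O\\ O&O&O\\ B_0&B_1&B_2-(1-q^\lambda)I_2\end{pmatrix},\quad F_\infty=I_6-\begin{pmatrix}B_0&B_1&B_2\\ B_0&B_1&B_2\\ B_0&B_1&B_2\end{pmatrix}.$$ *)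

theory Defs
  imports "HOL-Analysis.Analysis"
begin

section \<open>The q-Heun operator\<close>

text \<open>\<open>rq\<close> stands for the chosen square root of \<open>q\<close>, \<open>S\<close> for
  \<open>(l1 l2 l3 l4 h1 h2)^(1/2)\<close> and \<open>r\<close> for \<open>h3^(1/2)\<close>. The square roots are arguments; which
  branches they are is prescribed where the operator is used.\<close>

definition q_heun ::
  "complex \<Rightarrow> complex \<Rightarrow> complex \<Rightarrow> complex \<Rightarrow> complex \<Rightarrow> complex \<Rightarrow> complex \<Rightarrow> complex \<Rightarrow>
   complex \<Rightarrow> complex \<Rightarrow> complex \<Rightarrow> (complex \<Rightarrow> complex) \<Rightarrow> complex \<Rightarrow> complex" where
  "q_heun q rq l1 l2 l3 l4 h1 h2 S r E g x =
     (x - h1 * rq) * (x - h2 * rq) * g (x / q)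
     + l3 * l4 * (x - l1 / rq) * (x - l2 / rq) * g (q * x)
     - ((l3 + l4) * x^2 + l3 * l4 * E * x + S * (r + 1 / r)) * g x"


section \<open>Domains, Jackson integral and kernel\<close>

text \<open>Sets on which a q-difference equation can be imposed pointwise.\<close>

definition q_stable :: "complex \<Rightarrow> complex set \<Rightarrow> bool" where
  "q_stable q D \<longleftrightarrow> 0 \<notin> D \<and> (\<forall>x. x \<in> D \<longleftrightarrow> q * x \<in> D)"

text \<open>The points at which the Jackson integral from \<open>0\<close> to \<open>\<xi>\<infinity>\<close> samples its integrand.\<close>

definition q_lattice :: "complex \<Rightarrow> complex \<Rightarrow> complex set" where
  "q_lattice q \<xi> = range (\<lambda>n::int. q powi n * \<xi>)"

definition jackson :: "complex \<Rightarrow> complex \<Rightarrow> (complex \<Rightarrow> complex) \<Rightarrow> complex" where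
  "jackson q \<xi> f = (1 - q) * (\<Sum>\<^sub>\<infinity>n::int. q powi n * \<xi> * f (q powi n * \<xi>))"

definition jackson_abs_conv :: "complex \<Rightarrow> complex \<Rightarrow> (complex \<Rightarrow> complex) \<Rightarrow> bool" where
  "jackson_abs_conv q \<xi> f \<longleftrightarrow>
     (\<lambda>n::int. norm (q powi n * \<xi> * f (q powi n * \<xi>))) summable_on UNIV"

definition q_kernel :: "complex \<Rightarrow> complex \<Rightarrow> complex \<Rightarrow> complex \<Rightarrow> complex" where
  "q_kernel q lam x s =
     prodinf (\<lambda>i. (x - q powr (of_nat i + lam + 1) * s) / (x - q ^ (i + 1) * s))"


section \<open>The 2 by 2 linear system\<close>

definition b1_poly ::
  "complex \<Rightarrow> complex \<Rightarrow> complex \<Rightarrow> complex \<Rightarrow> complex \<Rightarrow> complex \<Rightarrow> complex \<Rightarrow> complex \<Rightarrow>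
   complex \<Rightarrow> complex \<Rightarrow> complex \<Rightarrow> complex \<Rightarrow> complex" where
  "b1_poly q t \<theta>1 \<theta>2 \<chi>1 \<chi>2 a1 a2 a3 a4 y z =
     q^2 * \<chi>1^2 * \<chi>2 * (y - a3) * (y - a4) * z^2
     + (y - t * a2) * (\<chi>2 * y - \<chi>1 * t * a1)
     - q * \<chi>1 * (2 * \<chi>2 * y^2
         - (\<chi>1 * t * a1 + \<chi>2 * t * a2 + \<chi>2 * a3 + \<chi>2 * a4) * y + t * (\<theta>1 + \<theta>2)) * z"

definition b2_poly ::
  "complex \<Rightarrow> complex \<Rightarrow> complex \<Rightarrow> complex \<Rightarrow> complex \<Rightarrow> complex \<Rightarrow> complex \<Rightarrow> complex \<Rightarrow>
   complex \<Rightarrow> complex \<Rightarrow> complex \<Rightarrow> complex \<Rightarrow> complex" where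
  "b2_poly q t \<theta>1 \<theta>2 \<chi>1 \<chi>2 a1 a2 a3 a4 y z =
     q^2 * \<chi>1 * (y - a3) * (y - a4) * (\<chi>1 * y - \<chi>2 * t * a1) * z^2
     + (y - t * a1)^2 * (y - t * a2)
     - q * (y - t * a1) * (2 * \<chi>1 * y^2
         - (\<chi>2 * t * a1 + \<chi>1 * t * a2 + \<chi>1 * a3 + \<chi>1 * a4) * y + t * (\<theta>1 + \<theta>2)) * z"

text \<open>The coefficient matrix at the pole \<open>t a1\<close>; the one at \<open>t a2\<close> is obtained by exchanging the
  arguments \<open>a1\<close> and \<open>a2\<close>, with \<open>y\<close> and \<open>z\<close> unchanged.\<close>

definition B_pole ::
  "complex \<Rightarrow> complex \<Rightarrow> complex \<Rightarrow> complex \<Rightarrow> complex \<Rightarrow> complex \<Rightarrow> complex \<Rightarrow> complex \<Rightarrow>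
   complex \<Rightarrow> complex \<Rightarrow> complex \<Rightarrow> complex \<Rightarrow> complex \<Rightarrow> complex^2^2" where
  "B_pole q t w \<theta>1 \<theta>2 \<chi>1 \<chi>2 a1 a2 a3 a4 y z =
    (let c1 = b1_poly q t \<theta>1 \<theta>2 \<chi>1 \<chi>2 a1 a2 a3 a4 y z;
         c2 = b2_poly q t \<theta>1 \<theta>2 \<chi>1 \<chi>2 a1 a2 a3 a4 y z
     in mat (a2 / (t * \<theta>1 * (a1 - a2))) **
        vector [vector [(y - t * a1) * c1 / (q * y * z * (\<chi>1 - \<chi>2)), w * \<chi>2 * (y - t * a1)],
                vector [- (c1 * c2 / (q^2 * w * y^2 * z^2 * (\<chi>1 - \<chi>2)^2)),
                        - (\<chi>2 * c2 / (q * y * z * (\<chi>1 - \<chi>2)))]])"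

definition B_inf :: "complex \<Rightarrow> complex \<Rightarrow> complex \<Rightarrow> complex \<Rightarrow> complex \<Rightarrow> complex \<Rightarrow> complex^2^2" where
  "B_inf t \<theta>1 \<chi>1 \<chi>2 a1 a2 =
     mat (t * a1 * a2 / \<theta>1) ** vector [vector [\<chi>1, 0], vector [0, \<chi>2]]"

definition two_pole :: "complex^'n^'n \<Rightarrow> complex^'n^'n \<Rightarrow> complex^'n^'n \<Rightarrow> complex \<Rightarrow> complex \<Rightarrow>
    complex \<Rightarrow> complex^'n^'n" where
  "two_pole Minf M1 M2 p1 p2 x =
     Minf + mat (1 / (1 - x / p1)) ** M1 + mat (1 / (1 - x / p2)) ** M2"


section \<open>The q-convolution: the 6 by 6 system\<close>

text \<open>Block indices have type \<open>3\<close>, whose elements are \<open>0\<close>, \<open>1\<close>, \<open>2\<close>; rows and columns of a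
  6 by 6 matrix are indexed by pairs of a block index and an index inside the block.\<close>

definition block_matrix :: "(3 \<Rightarrow> 3 \<Rightarrow> complex^2^2) \<Rightarrow> complex^(3 \<times> 2)^(3 \<times> 2)" where
  "block_matrix M = (\<chi> p r. M (fst p) (fst r) $ snd p $ snd r)"

definition F_pole :: "complex \<Rightarrow> (3 \<Rightarrow> complex^2^2) \<Rightarrow> 3 \<Rightarrow> complex^(3 \<times> 2)^(3 \<times> 2)" where
  "F_pole qlam B k = block_matrix
     (\<lambda>i j. if i = k then (if j = k then B j - mat (1 - qlam) else B j) else 0)"

definition F_inf :: "(3 \<Rightarrow> complex^2^2) \<Rightarrow> complex^(3 \<times> 2)^(3 \<times> 2)" where
  "F_inf B = mat 1 - block_matrix (\<lambda>i j. B j)"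

definition Y_hat_integrand ::
  "complex \<Rightarrow> complex \<Rightarrow> (3 \<Rightarrow> complex) \<Rightarrow> (complex \<Rightarrow> complex^2) \<Rightarrow> complex \<Rightarrow> 3 \<times> 2 \<Rightarrow>
   complex \<Rightarrow> complex" where
  "Y_hat_integrand q lam b Y x p s = q_kernel q lam x s / (s - b (fst p)) * Y s $ snd p"

definition Y_hat ::
  "complex \<Rightarrow> complex \<Rightarrow> complex \<Rightarrow> (3 \<Rightarrow> complex) \<Rightarrow> (complex \<Rightarrow> complex^2) \<Rightarrow> complex \<Rightarrow>
   complex^(3 \<times> 2)" where
  "Y_hat q lam \<xi> b Y x = (\<chi> p. jackson q \<xi> (Y_hat_integrand q lam b Y x p))"


section \<open>The transformed function\<close>

definition g_check_integrand ::
  "complex \<Rightarrow> complex \<Rightarrow> (complex \<Rightarrow> complex) \<Rightarrow> complex \<Rightarrow> complex \<Rightarrow> complex" where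
  "g_check_integrand q lam g x s = g s / (s - x) * q_kernel q lam x s"

definition g_check ::
  "complex \<Rightarrow> complex \<Rightarrow> complex \<Rightarrow> (complex \<Rightarrow> complex) \<Rightarrow> complex \<Rightarrow> complex" where
  "g_check q lam \<xi> g x = jackson q \<xi> (g_check_integrand q lam g x)"

end

(* Write L for the q-Heun operator, P for the kernel, A(s) and C(s) for the coefficients of
   g(s/q) and g(qs) in the equation for g, and put mu = q^lambda = q/l4. The proof rests on a
   kernel function identity: applying the primed operator L' in x to s P(x,s)/(s-x) gives the same
   as applying the formal adjoint (with respect to shifts of s) of the operator L in s to
   mu x P(x,s)/(s-x). Hence, where L g = 0, the integrand of L' applied to the transform is a
   difference U(s) - U(s/q) with
     U(s) = mu x ( P(x,qs) A(qs) g(s)/(qs-x) - P(x,s) C(s) g(qs)/(s-x) ),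
   and its bilateral sum vanishes as soon as U is summable over the lattice. Summability of P g
   alone does not suffice at infinity; together with that of the second component P y2 it does. *)

theory Submission
  imports Defs
begin

section \<open>The lattice \<open>q powi n * \<xi>\<close>: shifts and growth estimates\<close>

lemma q_lattice_iff: "s \<in> q_lattice q \<xi> \<longleftrightarrow> (\<exists>n::int. s = q powi n * \<xi>)"
  by (auto simp: q_lattice_def)

lemma q_lattice_shift:
  assumes "q \<noteq> 0"
  shows "q * s \<in> q_lattice q \<xi> \<longleftrightarrow> s \<in> q_lattice q \<xi>"
proof
  assume "q * s \<in> q_lattice q \<xi>"
  then obtain n :: int where "q * s = q powi n * \<xi>" by (auto simp: q_lattice_iff)
  then have "s = q powi (n - 1) * \<xi>"
    using assms by (simp add: power_int_diff field_simps)
  then show "s \<in> q_lattice q \<xi>" by (auto simp: q_lattice_iff)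
next
  assume "s \<in> q_lattice q \<xi>"
  then obtain n :: int where "s = q powi n * \<xi>" by (auto simp: q_lattice_iff)
  then have "q * s = q powi (n + 1) * \<xi>"
    using assms by (simp add: power_int_add)
  then show "q * s \<in> q_lattice q \<xi>" unfolding q_lattice_iff by blast
qed

lemma q_lattice_power:
  assumes "q \<noteq> 0" "s \<in> q_lattice q \<xi>"
  shows "q ^ i * s \<in> q_lattice q \<xi>"
  using assms by (induction i) (simp_all add: q_lattice_shift mult.assoc)

text \<open>Makes the equation for \<open>g\<close> available at every point sampled by the Jackson
  integral.\<close>

lemma q_lattice_subset:
  assumes "q_stable q G" "\<xi> \<in> G" "q \<noteq> 0"
  shows "q_lattice q \<xi> \<subseteq> G"
proof -
  have "q powi n * \<xi> \<in> G" for n :: int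
  proof (induction n rule: int_induct[where k = 0])
    case base
    then show ?case using assms by simp
  next
    case (step1 i)
    then have "q * (q powi i * \<xi>) \<in> G" using assms by (simp add: q_stable_def)
    then show ?case using assms by (simp add: power_int_add mult_ac)
  next
    case (step2 i)
    have "q * (q powi (i - 1) * \<xi>) = q powi i * \<xi>"
      using assms by (simp add: power_int_diff)
    then show ?case using assms step2 by (metis q_stable_def)
  qed
  then show ?thesis by (auto simp: q_lattice_def)
qed

text \<open>Along the lattice \<open>(1 + norm s) / norm (s - x)\<close> tends to
  \<open>1 / norm x\<close> as \<open>s\<close> approaches 0 and to 1 as \<open>s\<close> goes to
  infinity, so it is bounded on both halves; as \<open>x\<close> is off the lattice, the denominator
  may be cleared.\<close>

lemma q_lattice_bounded_ratio:
  fixes q \<xi> x :: complex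
  assumes q: "q \<noteq> 0" "norm q < 1" and "\<xi> \<noteq> 0" "x \<noteq> 0" and x: "x \<notin> q_lattice q \<xi>"
  obtains K where "\<And>s. s \<in> q_lattice q \<xi> \<Longrightarrow> 1 + norm s \<le> K * norm (s - x)"
proof -
  let ?f = "\<lambda>n::int. (1 + norm (q powi n * \<xi>)) / norm (q powi n * \<xi> - x)"
  have lim: "(\<lambda>n. q ^ n) \<longlonglongrightarrow> 0" using q by (simp add: LIMSEQ_power_zero)
  have "(\<lambda>n::nat. ?f (int n)) \<longlonglongrightarrow> (1 + norm (0 * \<xi>)) / norm (0 * \<xi> - x)"
    unfolding power_int_of_nat using \<open>x \<noteq> 0\<close> by (intro tendsto_intros lim) auto
  then have "Bseq (\<lambda>n::nat. ?f (int n))" by (intro convergent_imp_Bseq convergentI)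
  then obtain K1 where K1: "\<And>n::nat. norm (?f (int n)) \<le> K1" by (auto simp: Bseq_def)
  \<comment> \<open>Towards infinity, numerator and denominator are multiplied by
    \<open>norm (q ^ n)\<close>, which gives both a finite limit.\<close>
  have "(\<lambda>n::nat. (norm (q ^ n) + norm \<xi>) / norm (\<xi> - x * q ^ n))
      \<longlonglongrightarrow> (norm (0::complex) + norm \<xi>) / norm (\<xi> - x * 0)"
    using \<open>\<xi> \<noteq> 0\<close> by (intro tendsto_intros lim) auto
  moreover have "?f (- int n) = (norm (q ^ n) + norm \<xi>) / norm (\<xi> - x * q ^ n)" for n
  proof -
    define r where "r = norm (q ^ n)"
    have "r \<noteq> 0" using q by (simp add: r_def)
    have s: "q powi (- int n) * \<xi> = \<xi> / q ^ n"
      by (simp add: power_int_minus divide_inverse)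
    have "\<xi> / q ^ n - x = (\<xi> - x * q ^ n) / q ^ n"
      using q by (simp add: diff_divide_distrib)
    then have 1: "norm (q powi (- int n) * \<xi> - x) = norm (\<xi> - x * q ^ n) / r"
      unfolding s by (simp only: norm_divide r_def)
    have "norm (q powi (- int n) * \<xi>) = norm \<xi> / r"
      unfolding s by (simp only: norm_divide r_def)
    then have 2: "1 + norm (q powi (- int n) * \<xi>) = (r + norm \<xi>) / r"
      using \<open>r \<noteq> 0\<close> by (simp add: add_divide_distrib)
    show ?thesis
      unfolding 1 2 using \<open>r \<noteq> 0\<close> by (simp flip: r_def)
  qed
  ultimately have "Bseq (\<lambda>n::nat. ?f (- int n))"
    by (simp only:) (intro convergent_imp_Bseq convergentI)
  then obtain K2 where K2: "\<And>n::nat. norm (?f (- int n)) \<le> K2" by (auto simp: Bseq_def)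
  have *: "?f n \<le> max K1 K2" for n :: int
    by (cases n rule: int_cases2) (use K1 K2 in \<open>force simp: le_max_iff_disj\<close>)+
  show thesis
  proof
    fix s assume s: "s \<in> q_lattice q \<xi>"
    then obtain n :: int where n: "s = q powi n * \<xi>" by (auto simp: q_lattice_iff)
    have "norm (s - x) > 0" using s x by auto
    then show "1 + norm s \<le> max K1 K2 * norm (s - x)"
      using *[of n] n by (simp add: field_simps)
  qed
qed

text \<open>A quadratic numerator is at most a multiple of \<open>(1 + norm s)^2\<close>, and each
  of \<open>s - x\<close> and \<open>q * s - x\<close> absorbs one factor \<open>1 + norm s\<close>.
  This bounds the multipliers of \<open>Y\<close> in \<open>U\<close>.\<close>

lemma q_lattice_bounded_quotient:
  fixes q \<xi> x \<alpha> \<beta> \<gamma> :: complex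
  assumes q: "q \<noteq> 0" "norm q < 1" and "\<xi> \<noteq> 0" "x \<noteq> 0" and x: "x \<notin> q_lattice q \<xi>"
  obtains K where "\<And>s. s \<in> q_lattice q \<xi> \<Longrightarrow>
    norm ((\<alpha> * s^2 + \<beta> * s + \<gamma>) / ((s - x) * (q * s - x))) \<le> K"
proof -
  obtain K where K: "\<And>s. s \<in> q_lattice q \<xi> \<Longrightarrow> 1 + norm s \<le> K * norm (s - x)"
    using q_lattice_bounded_ratio assms by metis
  let ?M = "norm \<alpha> + norm \<beta> + norm \<gamma>"
  show thesis
  proof
    fix s assume s: "s \<in> q_lattice q \<xi>"
    then have qs: "q * s \<in> q_lattice q \<xi>" using q by (simp add: q_lattice_shift)
    have pos: "norm (s - x) > 0" "norm (q * s - x) > 0" using s qs x by auto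
    \<comment> \<open>The ratio bound is applied at \<open>q * s\<close>; returning to
      \<open>s\<close> costs a factor \<open>1 / norm q\<close>.\<close>
    have "norm q * (1 + norm s) \<le> 1 + norm (q * s)"
      using q by (simp add: norm_mult algebra_simps)
    also have "\<dots> \<le> K * norm (q * s - x)" using K[OF qs] .
    finally have 2: "1 + norm s \<le> (K / norm q) * norm (q * s - x)"
      using q by (simp add: field_simps)
    have "norm (\<alpha> * s^2 + \<beta> * s + \<gamma>) \<le> norm \<alpha> * norm s ^ 2 + norm \<beta> * norm s + norm \<gamma>"
      by (metis (no_types, opaque_lifting) norm_triangle_mono norm_mult norm_power order_refl)
    also have "\<dots> \<le> ?M * (1 + norm s)^2"
    proof -
      have "norm \<alpha> * norm s ^ 2 \<le> norm \<alpha> * (1 + norm s)^2"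
        by (intro mult_left_mono power_mono) auto
      moreover have "norm \<beta> * norm s \<le> norm \<beta> * (1 + norm s)^2"
        by (intro mult_left_mono) (auto simp: power2_eq_square algebra_simps)
      moreover have "norm \<gamma> * 1 \<le> norm \<gamma> * (1 + norm s)^2"
        by (intro mult_left_mono) (auto simp: power2_eq_square algebra_simps)
      ultimately show ?thesis by (simp add: distrib_right)
    qed
    also have "(1 + norm s)^2 \<le> (K * norm (s - x)) * ((K / norm q) * norm (q * s - x))"
      unfolding power2_eq_square
      by (intro mult_mono 2 K[OF s]) (use K[OF s] in \<open>auto intro: order_trans[rotated]\<close>)
    finally have "norm (\<alpha> * s^2 + \<beta> * s + \<gamma>)
        \<le> ?M * ((K * norm (s - x)) * ((K / norm q) * norm (q * s - x)))"
      by (simp add: mult_left_mono)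
    then show "norm ((\<alpha> * s^2 + \<beta> * s + \<gamma>) / ((s - x) * (q * s - x))) \<le> ?M * (K * (K / norm q))"
      using pos by (simp add: norm_divide norm_mult divide_le_eq mult_ac)
  qed
qed

section \<open>The kernel: convergence and shift relations\<close>

text \<open>Each factor differs from 1 by \<open>q ^ (i + 1)\<close> times a quotient that stays
  bounded, since its denominator tends to \<open>x\<close>; comparison with a geometric series gives
  absolute convergence.\<close>

lemma q_kernel_convergent:
  fixes q x s :: complex
  assumes q: "q \<noteq> 0" "norm q < 1" and "x \<noteq> 0" and x: "\<And>i. x \<noteq> q ^ i * s"
  shows "convergent_prod (\<lambda>i. (x - q powr (of_nat i + lam + 1) * s) / (x - q ^ (i + 1) * s))"
proof -
  have lim: "(\<lambda>n. q ^ (n + 1)) \<longlonglongrightarrow> 0"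
    using q by (intro LIMSEQ_ignore_initial_segment) (simp add: LIMSEQ_power_zero)
  have "(\<lambda>n. (1 - q powr lam) * s / (x - q ^ (n + 1) * s))
      \<longlonglongrightarrow> (1 - q powr lam) * s / (x - 0 * s)"
    using \<open>x \<noteq> 0\<close> by (intro tendsto_intros lim) auto
  then have "Bseq (\<lambda>n. (1 - q powr lam) * s / (x - q ^ (n + 1) * s))"
    by (intro convergent_imp_Bseq convergentI)
  then obtain K where K: "\<And>n. norm ((1 - q powr lam) * s / (x - q ^ (n + 1) * s)) \<le> K"
    by (auto simp: Bseq_def)
  have eq: "(x - q powr (of_nat i + lam + 1) * s) / (x - q ^ (i + 1) * s) - 1
      = (1 - q powr lam) * s / (x - q ^ (i + 1) * s) * q ^ (i + 1)" for i
    using q x[of "i + 1"] by (simp add: powr_add powr_nat' divide_simps) (simp add: algebra_simps)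
  have "summable (\<lambda>i. norm ((x - q powr (of_nat i + lam + 1) * s) / (x - q ^ (i + 1) * s) - 1))"
  proof (rule summable_comparison_test')
    show "summable (\<lambda>i. K * norm q ^ (i + 1))"
      using q by (intro summable_mult summable_ignore_initial_segment summable_geometric) simp
    show "norm (norm ((x - q powr (of_nat i + lam + 1) * s) / (x - q ^ (i + 1) * s) - 1))
        \<le> K * norm q ^ (i + 1)" for i
      unfolding eq norm_mult norm_power real_norm_def abs_norm_cancel
      using mult_right_mono[OF K[of i], of "norm q ^ (i + 1)"] by (simp add: norm_mult norm_power)
  qed
  then show ?thesis
    by (intro abs_convergent_prod_imp_convergent_prod) (simp add: abs_convergent_prod_conv_summable)
qed

text \<open>Each factor is homogeneous of degree 0 in \<open>x\<close> and \<open>s\<close>. This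
  trades a shift of \<open>s\<close> for the opposite shift of \<open>x\<close>.\<close>

lemma q_kernel_scale:
  assumes "q \<noteq> 0"
  shows "q_kernel q lam (q * x) (q * s) = q_kernel q lam x s"
proof -
  have "(q * x - c * (q * s)) / (q * x - d * (q * s)) = (x - c * s) / (x - d * s)" for c d
  proof -
    have "q * x - c * (q * s) = q * (x - c * s)" "q * x - d * (q * s) = q * (x - d * s)"
      by (simp_all add: algebra_simps)
    then show ?thesis using assms by simp
  qed
  then show ?thesis by (simp add: q_kernel_def)
qed

text \<open>Cancelling \<open>q\<close> in every factor at \<open>q * x\<close> lowers its index by
  one, so the shifted product is the old one with one new factor in front.\<close>

lemma q_kernel_shift:
  assumes q: "q \<noteq> 0" "norm q < 1" and "x \<noteq> 0" and x: "\<And>i. x \<noteq> q ^ i * s"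
  shows "q_kernel q lam (q * x) s = (x - q powr lam * s) / (x - s) * q_kernel q lam x s"
proof -
  \<comment> \<open>\<open>f 0\<close> is the new factor; the factors of the kernel at
    \<open>x\<close> are \<open>f (Suc i)\<close>.\<close>
  define f where "f = (\<lambda>i. (x - q ^ i * q powr lam * s) / (x - q ^ i * s))"
  have *: "(\<lambda>i. (x - q powr (of_nat i + lam + 1) * s) / (x - q ^ (i + 1) * s)) = (\<lambda>i. f (Suc i))"
    using q by (simp add: f_def powr_add powr_nat' fun_eq_iff mult_ac)
  have conv: "convergent_prod (\<lambda>i. f (Suc i))"
    using q_kernel_convergent[OF assms, of lam] unfolding * .
  have "(q * x - q powr (of_nat i + lam + 1) * s) / (q * x - q ^ (i + 1) * s) = f i" for i
  proof -
    have "q * x - q powr (of_nat i + lam + 1) * s = q * (x - q ^ i * q powr lam * s)"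
      "q * x - q ^ (i + 1) * s = q * (x - q ^ i * s)"
      using q by (simp_all add: powr_add powr_nat' algebra_simps)
    then show ?thesis using q by (simp add: f_def)
  qed
  then have "q_kernel q lam (q * x) s = prodinf f" by (simp add: q_kernel_def)
  also have "\<dots> = f 0 * (\<Prod>i. f (Suc i))"
  proof -
    have "convergent_prod f" using conv convergent_prod_iff_shift[of f 1] by simp
    from has_prod_ignore_initial_segment'[OF this, of 1] show ?thesis
      by (simp add: has_prod_unique[symmetric])
  qed
  finally show ?thesis unfolding q_kernel_def * by (simp add: f_def)
qed

section \<open>Bilateral telescoping and the kernel function identity\<close>

text \<open>Translation by one permutes the integers, so both halves have the same sum; summability
  of \<open>U\<close> permits splitting the series.\<close>

lemma infsum_int_telescope:
  fixes U :: "int \<Rightarrow> 'a::real_normed_vector"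
  assumes "U summable_on UNIV"
  shows "(\<Sum>\<^sub>\<infinity>n. U n - U (n - 1)) = 0"
proof -
  have bij: "bij_betw (\<lambda>n::int. n - 1) UNIV UNIV"
    by (rule bij_betwI[where g = "\<lambda>n. n + 1"]) auto
  have "(\<lambda>n. U (n - 1)) summable_on UNIV"
    using assms summable_on_reindex_bij_betw[OF bij, of U] by simp
  then have "(\<Sum>\<^sub>\<infinity>n. U n - U (n - 1)) = infsum U UNIV - (\<Sum>\<^sub>\<infinity>n. U (n - 1))"
    using assms infsum_add[of U UNIV "\<lambda>n. - U (n - 1)"]
    by (simp add: summable_on_uminus infsum_uminus)
  also have "(\<Sum>\<^sub>\<infinity>n. U (n - 1)) = infsum U UNIV"
    by (rule infsum_reindex_bij_betw[OF bij])
  finally show ?thesis by simp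
qed

text \<open>The identity is applied with \<open>P(x,s) = k1 P(x/q,s)\<close> and \<open>P(qx,s) = k2 P(x/q,s)\<close>.
  Dividing by \<open>P(x/q,s)\<close> rather than by \<open>P(x,s)\<close> keeps the identity valid when \<open>P(x,s) = 0\<close>.\<close>

lemma kernel_identity:
  fixes p q x s l1 l2 l3 l4 h1 h2 h3 E \<mu> :: complex
  assumes nz: "q \<noteq> 0" "l4 \<noteq> 0" "h1 \<noteq> 0" "h2 \<noteq> 0" "h3 \<noteq> 0"
    and p: "p^2 = q"
    and rel: "l1 * l2 * l3 * l4 = h1 * h2 * h3 * q^2"
    and \<mu>: "\<mu> = q / l4"
    and ne: "s \<noteq> x" "q * s \<noteq> x" "s \<noteq> q * x"
    and k1: "k1 = (x - q * \<mu> * s) / (x - q * s)"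
    and k2: "k2 = (x - \<mu> * s) / (x - s) * k1"
  shows "(x - q * h1 / l4 * p) * (x - q * h2 / l4 * p) * (s / (s - x / q))
      + l3 * q * (x - l1 / p) * (x - l2 / p) * (s / (s - q * x) * k2)
      - ((l3 + q) * x^2 + l3 * q * E * x + l1 * l2 * l3 * (1 / h3 + q / l4)) * (s / (s - x) * k1)
    = \<mu> * x * ((q * s - h1 * p) * (q * s - h2 * p) / (q * s - x)
      + l3 * l4 * (s / q - l1 / p) * (s / q - l2 / p) * (k2 / (s / q - x))
      - ((l3 + l4) * s^2 + l3 * l4 * E * s + q * h1 * h2 * (1 + h3)) * (k1 / (s - x)))"
proof -
  have p0: "p \<noteq> 0" using p nz by auto
  have \<mu>0: "\<mu> \<noteq> 0" using \<mu> nz by simp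
  have l4: "l4 = q / \<mu>" using nz unfolding \<mu> by simp
  \<comment> \<open>The parameter relation removes \<open>h3\<close> from both constant terms,
    leaving at most \<open>\<mu>\<close> in a denominator.\<close>
  have n: "l1 * l2 * l3 / h3 = \<mu> * q * h1 * h2"
    using rel nz unfolding \<mu> by (simp add: field_simps power2_eq_square)
  have m: "q * h1 * h2 * h3 = l1 * l2 * l3 / \<mu>"
    using rel nz unfolding \<mu> by (simp add: field_simps power2_eq_square)
  have c1: "l1 * l2 * l3 * (1 / h3 + q / l4) = \<mu> * q * h1 * h2 + \<mu> * l1 * l2 * l3"
    using n \<mu> by (simp add: algebra_simps)
  have c2: "q * h1 * h2 * (1 + h3) = q * h1 * h2 + l1 * l2 * l3 / \<mu>"
    using m by (simp add: algebra_simps)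
  have d: "x - s \<noteq> 0" "x - q * s \<noteq> 0" "s - q * x \<noteq> 0" "s - x \<noteq> 0" "q * s - x \<noteq> 0" using ne by auto
  have e1: "(x - q * h1 / l4 * p) * (x - q * h2 / l4 * p)
      = x^2 - \<mu> * p * (h1 + h2) * x + \<mu>^2 * h1 * h2 * q"
    unfolding \<mu> p[symmetric] by (simp add: algebra_simps power2_eq_square add_divide_distrib)
  have e2: "l3 * q * (x - l1 / p) * (x - l2 / p) = l3 * (q * x^2 - p * (l1 + l2) * x + l1 * l2)"
    using p0 unfolding p[symmetric] by (simp add: field_simps power2_eq_square)
  have e3: "(q * s - h1 * p) * (q * s - h2 * p) = q^2 * s^2 - q * p * (h1 + h2) * s + h1 * h2 * q"
    unfolding p[symmetric] by (simp add: algebra_simps power2_eq_square)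
  have e4: "l3 * l4 * (s / q - l1 / p) * (s / q - l2 / p)
      = l3 * (s^2 - p * (l1 + l2) * s + l1 * l2 * q) / (q * \<mu>)"
    using p0 \<mu>0 unfolding l4 p[symmetric] by (simp add: field_simps power2_eq_square)
  have f: "s / (s - x / q) = q * s / (q * s - x)" "s / q - x = (s - q * x) / q"
    using nz d by (simp_all add: field_simps)
  have k1': "k1 = - (x - q * \<mu> * s) / (q * s - x)" 
    unfolding k1 using d by (simp add: divide_simps) (simp add: algebra_simps)
  have k2': "k2 = (x - \<mu> * s) * (x - q * \<mu> * s) / ((s - x) * (q * s - x))" 
    unfolding k2 k1 using d by (simp add: divide_simps) (simp add: algebra_simps)
  \<comment> \<open>\<open>T1\<close>, \<open>T2\<close>, \<open>T3\<close> are the coefficients of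
    the primed operator at \<open>x\<close>, \<open>A\<close> is a coefficient of the original one
    at \<open>q * s\<close>, and \<open>C\<close> and \<open>V\<close> are those at
    \<open>s / q\<close> and \<open>s\<close> multiplied by \<open>q * \<mu>\<close> and
    \<open>\<mu>\<close>.\<close>
  define T1 T2 T3 A C V where
    "T1 = x^2 - \<mu> * p * (h1 + h2) * x + \<mu>^2 * h1 * h2 * q" and
    "T2 = l3 * (q * x^2 - p * (l1 + l2) * x + l1 * l2)" and
    "T3 = (l3 + q) * x^2 + l3 * q * E * x + (\<mu> * q * h1 * h2 + \<mu> * l1 * l2 * l3)" and
    "A = q^2 * s^2 - q * p * (h1 + h2) * s + h1 * h2 * q" and
    "C = l3 * (s^2 - p * (l1 + l2) * s + l1 * l2 * q)" and
    "V = (\<mu> * l3 + q) * s^2 + l3 * q * E * s + (\<mu> * q * h1 * h2 + l1 * l2 * l3)"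
  \<comment> \<open>The claim after multiplication by
    \<open>(s - x) * (q * s - x) * (s - q * x)\<close>.\<close>
  have poly: "T1 * (q * s) * (s - x) * (s - q * x)
        + (T2 * s * (x - \<mu> * s) + T3 * s * (s - q * x)) * (x - q * \<mu> * s)
      = x * (\<mu> * A * (s - x) * (s - q * x)
        + (C * (x - \<mu> * s) + V * (s - q * x)) * (x - q * \<mu> * s))"
    unfolding T1_def T2_def T3_def A_def C_def V_def by algebra
  have V: "(l3 + l4) * s^2 + l3 * l4 * E * s + q * h1 * h2 * (1 + h3) = V / \<mu>"
    unfolding c2 V_def l4 using \<mu>0 by (simp add: field_simps)
  define a where "a = s - x"
  define b where "b = q * s - x"
  define c where "c = s - q * x"
  define N where "N = x - q * \<mu> * s"
  define M where "M = x - \<mu> * s"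
  have abc: "a \<noteq> 0" "b \<noteq> 0" "c \<noteq> 0" using d by (simp_all add: a_def b_def c_def)
  have "T1 * (q * s / b) + T2 * (s / c * (M * N / (a * b))) - T3 * (s / a * (- N / b))
      = (T1 * (q * s) * a * c + (T2 * s * M + T3 * s * c) * N) / (a * b * c)"
    using abc by (simp add: field_simps)
  also have "\<dots> = x * (\<mu> * A * a * c + (C * M + V * c) * N) / (a * b * c)"
    using poly unfolding a_def c_def M_def N_def by (simp only:)
  also have "\<dots> = \<mu> * x * (A / b + C / (q * \<mu>) * (M * N / (a * b) / (c / q)) - V / \<mu> * (- N / b / a))"
    using abc \<mu>0 nz by (simp add: field_simps)
  finally show ?thesis
    unfolding e1 e2 e3 e4 c1 V f k1' k2'
      T1_def[symmetric] T2_def[symmetric] T3_def[symmetric] A_def[symmetric] C_def[symmetric]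
      a_def[symmetric] b_def[symmetric] c_def[symmetric] M_def[symmetric] N_def[symmetric]
    by simp
qed

section \<open>Jackson integrals: linearity, telescoping and comparison\<close>

lemma jackson_linear:
  assumes "jackson_abs_conv q \<xi> f1" "jackson_abs_conv q \<xi> f2" "jackson_abs_conv q \<xi> f3"
  shows "c1 * jackson q \<xi> f1 + c2 * jackson q \<xi> f2 - c3 * jackson q \<xi> f3
    = jackson q \<xi> (\<lambda>s. c1 * f1 s + c2 * f2 s - c3 * f3 s)"
proof -
  define F where "F = (\<lambda>(f :: complex \<Rightarrow> complex) (n :: int). q powi n * \<xi> * f (q powi n * \<xi>))"
  have "F f1 summable_on UNIV" "F f2 summable_on UNIV" "F f3 summable_on UNIV"
    using assms unfolding jackson_abs_conv_def F_def by (auto intro: abs_summable_summable)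
  then have "((\<lambda>n. c1 * F f1 n + c2 * F f2 n + (- c3) * F f3 n) has_sum
      (c1 * infsum (F f1) UNIV + c2 * infsum (F f2) UNIV + (- c3) * infsum (F f3) UNIV)) UNIV"
    by (intro has_sum_add has_sum_cmult_right has_sum_infsum)
  moreover have "(\<lambda>n. c1 * F f1 n + c2 * F f2 n + (- c3) * F f3 n)
      = F (\<lambda>s. c1 * f1 s + c2 * f2 s - c3 * f3 s)"
    by (simp add: F_def algebra_simps fun_eq_iff)
  ultimately have sum: "infsum (F (\<lambda>s. c1 * f1 s + c2 * f2 s - c3 * f3 s)) UNIV
      = c1 * infsum (F f1) UNIV + c2 * infsum (F f2) UNIV + (- c3) * infsum (F f3) UNIV"
    by (simp only: infsumI)
  have "jackson q \<xi> f = (1 - q) * infsum (F f) UNIV" for f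
    by (simp add: jackson_def F_def)
  then show ?thesis
    by (simp only: sum) (simp add: algebra_simps)
qed

text \<open>The Jackson sum carries the weight \<open>s\<close>, so \<open>s * f s\<close> rather
  than \<open>f s\<close> has to be a difference; \<open>s / q\<close> is the lattice point of index
  \<open>n - 1\<close>.\<close>

lemma jackson_telescope:
  assumes "q \<noteq> 0"
    and U: "(\<lambda>n::int. norm (U (q powi n * \<xi>))) summable_on UNIV"
    and f: "\<And>s. s \<in> q_lattice q \<xi> \<Longrightarrow> s * f s = U s - U (s / q)"
  shows "jackson q \<xi> f = 0"
proof -
  have "q powi n * \<xi> * f (q powi n * \<xi>) = U (q powi n * \<xi>) - U (q powi (n - 1) * \<xi>)" for n :: int
    using f[of "q powi n * \<xi>"] assms(1) by (auto simp: q_lattice_def power_int_diff)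
  then show ?thesis
    unfolding jackson_def
    using infsum_int_telescope[OF abs_summable_summable[OF U]] by simp
qed

text \<open>Used with the kernel times a component of \<open>Y\<close> as \<open>f\<close>, and with
  \<open>R1\<close> or \<open>R2\<close> as the bounded multiplier.\<close>

lemma q_lattice_abs_summable_mult:
  assumes f: "(\<lambda>n::int. norm (f (q powi n * \<xi>))) summable_on UNIV"
    and R: "\<And>s. s \<in> q_lattice q \<xi> \<Longrightarrow> norm (R s) \<le> (K::real)"
  shows "(\<lambda>n::int. norm (f (q powi n * \<xi>) * R (q powi n * \<xi>) :: complex)) summable_on UNIV"
proof (rule Infinite_Sum.abs_summable_on_comparison_test')
  show "(\<lambda>n::int. norm (f (q powi n * \<xi>)) * K) summable_on UNIV"
    using f by (rule summable_on_cmult_left)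
  show "norm (f (q powi n * \<xi>) * R (q powi n * \<xi>)) \<le> norm (f (q powi n * \<xi>)) * K" for n :: int
    unfolding norm_mult by (intro mult_left_mono R) (auto simp: q_lattice_def)
qed

lemma two_pole_nth:
  fixes Minf M1 M2 :: "complex^'n^'n"
  shows
  "two_pole Minf M1 M2 p1 p2 x $ i $ j
    = Minf $ i $ j + 1 / (1 - x / p1) * M1 $ i $ j + 1 / (1 - x / p2) * M2 $ i $ j"
proof -
  have *: "(mat c ** M) $ i $ j = c * M $ i $ j" for c :: complex and M :: "complex^'n^'n"
    by (simp add: matrix_matrix_mult_def mat_def if_distrib[of "\<lambda>a. a * _"] cong: if_cong)
  show ?thesis by (simp add: two_pole_def *)
qed

lemma B_inf_row1:
  "B_inf t \<theta>1 \<chi>1 \<chi>2 a1 a2 $ 1 $ 1 = t * a1 * a2 / \<theta>1 * \<chi>1" "B_inf t \<theta>1 \<chi>1 \<chi>2 a1 a2 $ 1 $ 2 = 0"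
  by (simp_all add: B_inf_def matrix_matrix_mult_def mat_def sum_2)

theorem theorem5p4:
  fixes q rq l1 l2 l3 l4 h1 h2 h3 E lam \<xi> :: complex
    and S r :: complex
    and l1' l2' l3' l4' h1' h2' h3' S' r' :: complex
    and t w \<theta>1 \<theta>2 a1 a2 a3 a4 \<chi>1 \<chi>2 y zden z :: complex
    and B :: "3 \<Rightarrow> complex^2^2" and Binf :: "complex^2^2" and b :: "3 \<Rightarrow> complex"
    and g :: "complex \<Rightarrow> complex" and Y :: "complex \<Rightarrow> complex^2"
    and G D :: "complex set"
  assumes q: "0 < norm q" "norm q < 1" "rq^2 = q"
    and nonzero: "l1 \<noteq> 0" "l2 \<noteq> 0" "l3 \<noteq> 0" "l4 \<noteq> 0" "h1 \<noteq> 0" "h2 \<noteq> 0" "h3 \<noteq> 0"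
    and relation: "l1 * l2 * l3 * l4 = h1 * h2 * h3 * q^2"
    and roots: "S^2 = l1 * l2 * l3 * l4 * h1 * h2" "r^2 = h3" "S * r = q * h1 * h2 * h3"
    and G: "q_stable q G" "\<xi> \<in> G"
    and g_eq: "\<And>x. x \<in> G \<Longrightarrow> q_heun q rq l1 l2 l3 l4 h1 h2 S r E g x = 0"
    and lam: "q powr lam = q / l4"
    and \<xi>: "\<xi> \<noteq> 0"
    and primed: "l1' = l1" "l2' = l2" "l3' = l3" "l4' = q"
      "h1' = q * h1 / l4" "h2' = q * h2 / l4" "h3' = l4 / (q * h3)"
    and roots': "S'^2 = l1' * l2' * l3' * l4' * h1' * h2'" "r'^2 = h3'" "S' * r' = l1 * l2 * l3 / h3"
    \<comment> \<open>the associated linear system\<close>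
    and params: "t = 1" "w = 1" "\<theta>1 = 1" "\<theta>2 = 1 / h3"
      "a1 = l1 / rq" "a2 = l2 / rq" "a3 = h1 * rq" "a4 = h2 / rq"
      "\<chi>1 = 1 / (l3 * a1 * a2)" "\<chi>2 = q / (l4 * a1 * a2)"
    and yz: "y = a3"
      "zden = q * t * (\<theta>1 + \<theta>2) + a3^2 * (q * \<chi>1 + \<chi>2) + E * q * \<theta>1 * a3 / (t * a1 * a2)"
      "z = (t * a1 - a3) * (t * a2 - a3) / zden"
    and matrices: "Binf = B_inf t \<theta>1 \<chi>1 \<chi>2 a1 a2"
      "B 1 = B_pole q t w \<theta>1 \<theta>2 \<chi>1 \<chi>2 a1 a2 a3 a4 y z"
      "B 2 = B_pole q t w \<theta>1 \<theta>2 \<chi>1 \<chi>2 a2 a1 a3 a4 y z"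
      "B 0 = mat 1 - Binf - B 1 - B 2"
    and poles: "b 0 = 0" "b 1 = t * a1" "b 2 = t * a2"
    \<comment> \<open>genericity: the denominators that occur do not vanish\<close>
    and generic: "a1 \<noteq> a2" "\<chi>1 \<noteq> \<chi>2" "zden \<noteq> 0" "z \<noteq> 0"
      "b 1 \<notin> q_lattice q \<xi>" "b 2 \<notin> q_lattice q \<xi>"
      "\<And>s. s \<in> q_lattice q \<xi> \<Longrightarrow> two_pole Binf (B 1) (B 2) (b 1) (b 2) s $ 1 $ 2 \<noteq> 0"
    \<comment> \<open>\<open>Y = (y1, y2)\<close> with \<open>y1 = g\<close>, and \<open>y2\<close> given by the first row of the system\<close>
    and Y1: "\<And>x. Y x $ 1 = g x"
    and Y2: "\<And>s. s \<in> q_lattice q \<xi> \<Longrightarrow>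
      Y (q * s) $ 1 = two_pole Binf (B 1) (B 2) (b 1) (b 2) s $ 1 $ 1 * Y s $ 1
                    + two_pole Binf (B 1) (B 2) (b 1) (b 2) s $ 1 $ 2 * Y s $ 2"
    \<comment> \<open>the standing assumption that makes precise the word ``formally''\<close>
    and D: "q_stable q D" "D \<inter> q_lattice q \<xi> = {}"
    and conv: "\<And>x p. x \<in> D \<Longrightarrow> jackson_abs_conv q \<xi> (Y_hat_integrand q lam b Y x p)"
      "\<And>x. x \<in> D \<Longrightarrow> jackson_abs_conv q \<xi> (g_check_integrand q lam g x)"
    and system: "\<And>x. \<lbrakk>x \<in> D; x \<noteq> b 1; x \<noteq> b 2\<rbrakk> \<Longrightarrow>
      Y_hat q lam \<xi> b Y (q * x) =
        two_pole (F_inf B) (F_pole (q powr lam) B 1) (F_pole (q powr lam) B 2) (b 1) (b 2) x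
          *v Y_hat q lam \<xi> b Y x"
  shows "\<forall>x \<in> D. q_heun q rq l1' l2' l3' l4' h1' h2' S' r' E (g_check q lam \<xi> g) x = 0"
proof

  \<comment> \<open>Points of \<open>D\<close>, kernel ratios and the function
    \<open>U\<close>\<close>
  fix x assume x: "x \<in> D"
  define \<mu> where "\<mu> = q powr lam"
  have \<mu>: "\<mu> = q / l4" using lam by (simp add: \<mu>_def)
  have q0: "q \<noteq> 0" using q by auto
  have rq0: "rq \<noteq> 0" using q q0 by auto
  let ?L = "q_lattice q \<xi>"
  let ?P = "q_kernel q lam"
  have D_shift: "u \<in> D \<longleftrightarrow> q * u \<in> D" for u using D(1) by (simp add: q_stable_def)
  have xD: "q * x \<in> D" "x / q \<in> D" using x q0 D_shift[of x] D_shift[of "x / q"] by auto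
  have nz: "u \<noteq> 0" if "u \<in> D" for u using that D(1) by (auto simp: q_stable_def)
  have off: "u \<notin> ?L" if "u \<in> D" for u using that D(2) by auto
  have Lq: "q * s \<in> ?L" if "s \<in> ?L" for s using that q0 by (simp add: q_lattice_shift)
  \<comment> \<open>Guarantees that no factor of the kernel has a vanishing denominator at points of
    \<open>D\<close>.\<close>
  have off_pow: "u \<noteq> q ^ i * s" if "u \<in> D" "s \<in> ?L" for u s i
    using q_lattice_power[OF q0 that(2)] off[OF that(1)] by metis
  have ne: "s \<noteq> x" "q * s \<noteq> x" "s \<noteq> q * x" if "s \<in> ?L" for s
    using that off[OF x] off[OF xD(1)] Lq by auto
  \<comment> \<open>Ratios of the kernels at \<open>x\<close> and \<open>q * x\<close> to the one at
    \<open>x / q\<close>.\<close>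
  define k1 where "k1 = (\<lambda>s. (x - q * \<mu> * s) / (x - q * s))"
  define k2 where "k2 = (\<lambda>s. (x - \<mu> * s) / (x - s) * k1 s)"
  have P1: "?P x s = k1 s * ?P (x / q) s" if "s \<in> ?L" for s
  proof -
    have "?P (q * (x / q)) s = (x / q - \<mu> * s) / (x / q - s) * ?P (x / q) s"
      unfolding \<mu>_def using q0 q(2) nz[OF xD(2)] off_pow[OF xD(2) that] by (rule q_kernel_shift)
    moreover have "(x / q - \<mu> * s) / (x / q - s) = k1 s"
    proof -
      have "x / q - \<mu> * s = (x - q * \<mu> * s) / q" "x / q - s = (x - q * s) / q"
        using q0 by (simp_all add: field_simps)
      then show ?thesis using q0 by (simp add: k1_def)
    qed
    ultimately show ?thesis using q0 by simp
  qed
  have P2: "?P (q * x) s = k2 s * ?P (x / q) s" if "s \<in> ?L" for s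
    using q_kernel_shift[OF q0 q(2) nz[OF x] off_pow[OF x that], of lam] P1[OF that]
    by (simp add: k2_def \<mu>_def)
  define A where "A = (\<lambda>u. (u - h1 * rq) * (u - h2 * rq))"
  define C where "C = (\<lambda>u. l3 * l4 * (u - l1 / rq) * (u - l2 / rq))"
  define V where "V = (\<lambda>u. (l3 + l4) * u^2 + l3 * l4 * E * u + q * h1 * h2 * (1 + h3))"
  define U where "U = (\<lambda>s. \<mu> * x *
    (?P (x / q) s * A (q * s) / (q * s - x) * g s - ?P x s * C s / (s - x) * g (q * s)))"
  define c1 c2 c3 where "c1 = (x - h1' * rq) * (x - h2' * rq)"
    and "c2 = l3' * l4' * (x - l1' / rq) * (x - l2' / rq)"
    and "c3 = (l3' + l4') * x^2 + l3' * l4' * E * x + S' * (r' + 1 / r')"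
  define f where "f = (\<lambda>s. c1 * g_check_integrand q lam g (x / q) s
    + c2 * g_check_integrand q lam g (q * x) s - c3 * g_check_integrand q lam g x s)"

  \<comment> \<open>Constant terms and the difference form of the integrand\<close>
  have const: "S * (r + 1 / r) = q * h1 * h2 * (1 + h3)"
  proof -
    have "r \<noteq> 0" using roots nonzero by auto
    \<comment> \<open>Writing \<open>S / r\<close> as \<open>S * r / r^2\<close> expresses the
      constant term through the prescribed product \<open>S * r\<close> and
      \<open>r^2 = h3\<close>.\<close>
    have "S * (r + 1 / r) = S * r + S * r / r^2"
      using \<open>r \<noteq> 0\<close> by (simp add: field_simps power2_eq_square)
    then show ?thesis using roots nonzero by (simp add: algebra_simps)
  qed
  have const': "S' * (r' + 1 / r') = l1 * l2 * l3 * (1 / h3 + q / l4)"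
  proof -
    have "r' \<noteq> 0" using roots' primed nonzero q0 by auto
    have "S' * (r' + 1 / r') = S' * r' + S' * r' / r'^2"
      using \<open>r' \<noteq> 0\<close> by (simp add: field_simps power2_eq_square)
    also have "\<dots> = l1 * l2 * l3 / h3 + (l1 * l2 * l3 / h3) / (l4 / (q * h3))"
      using roots' primed by simp
    finally show ?thesis using nonzero by (simp add: algebra_simps)
  qed

  \<comment> \<open>The equation for \<open>g\<close> replaces \<open>A s * g (s / q)\<close> in
    \<open>U (s / q)\<close>; the terms with \<open>g (q * s)\<close> then cancel, and the kernel
    identity rewrites the remaining coefficient of \<open>g s\<close>.\<close>
  have step: "s * f s = U s - U (s / q)" if s: "s \<in> ?L" for s
  proof -
    have "s \<in> G" using q_lattice_subset[OF G q0] s by auto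
    from g_eq[OF this] have heun: "A s * g (s / q) = V s * g s - C s * g (q * s)"
      unfolding q_heun_def const A_def C_def V_def by (simp add: algebra_simps)
    \<comment> \<open>Turns kernels at \<open>s / q\<close> into kernels at \<open>s\<close> with
      \<open>x\<close> shifted, so that \<open>P1\<close> and \<open>P2\<close> apply.\<close>
    have shift: "?P u (s / q) = ?P (q * u) s" for u
      using q_kernel_scale[OF q0, of lam u "s / q"] q0 by simp
    have "U (s / q) = \<mu> * x * (?P x s / (s - x) * (A s * g (s / q))
        - ?P (q * x) s * C (s / q) / (s / q - x) * g s)"
      unfolding U_def shift using q0 by simp
    then have "U s - U (s / q) = g s * ?P (x / q) s * (\<mu> * x * (A (q * s) / (q * s - x)
        + C (s / q) * (k2 s / (s / q - x)) - V s * (k1 s / (s - x))))"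
      unfolding U_def heun P1[OF s] P2[OF s] by (simp add: algebra_simps diff_divide_distrib)
    also have "\<dots> = g s * ?P (x / q) s * (c1 * (s / (s - x / q))
        + c2 * (s / (s - q * x) * k2 s) - c3 * (s / (s - x) * k1 s))"
      unfolding c1_def c2_def c3_def primed const' A_def C_def V_def
      by (subst kernel_identity[OF q0 nonzero(4-7) q(3) relation \<mu> ne[OF s], symmetric])
        (simp_all add: k1_def k2_def)
    also have "\<dots> = s * f s"
      unfolding f_def g_check_integrand_def P1[OF s] P2[OF s] by (simp add: algebra_simps)
    finally show ?thesis ..
  qed

  \<comment> \<open>Absolute summability of \<open>U\<close> over the lattice\<close>
  \<comment> \<open>The block with \<open>b 0 = 0\<close> contributes \<open>1 / s\<close>, which
    cancels the weight of the Jackson sum; at \<open>x / q\<close> this leaves the kernel to which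
    \<open>U\<close> is reduced.\<close>
  have sum_Y: "(\<lambda>n::int. norm (?P (x / q) (q powi n * \<xi>) * Y (q powi n * \<xi>) $ i)) summable_on UNIV" for i
    using conv(1)[OF xD(2), of "(0, i)"] \<xi> q0
    by (simp add: jackson_abs_conv_def Y_hat_integrand_def poles)
  \<comment> \<open>\<open>U\<close> grows like \<open>s P g\<close>, one power more than \<open>conv\<close> controls. Its leading part is removed by
    expressing \<open>g (q s)\<close> through \<open>Y\<close>: the cubic terms of the coefficient of \<open>g\<close> cancel because
    \<open>\<mu> l4 = q\<close>.\<close>
  define d1 d0 e1 e0 where
    "d1 = - l4 * (a1 + a2) - l3 * l4 * (a1 * B 1 $ 1 $ 1 + a2 * B 2 $ 1 $ 1)" and
    "d0 = l4 * a1 * a2 + l3 * l4 * a1 * a2 * (B 1 $ 1 $ 1 + B 2 $ 1 $ 1)" and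
    "e1 = - l3 * l4 * (a1 * B 1 $ 1 $ 2 + a2 * B 2 $ 1 $ 2)" and
    "e0 = l3 * l4 * a1 * a2 * (B 1 $ 1 $ 2 + B 2 $ 1 $ 2)"
  have a0: "a1 \<noteq> 0" "a2 \<noteq> 0" using params nonzero rq0 by auto
  \<comment> \<open>The zeros of \<open>C\<close> at \<open>a1\<close> and \<open>a2\<close> cancel
    the poles of the system. The leading coefficient is \<open>l4\<close> because
    \<open>\<chi>1 * a1 * a2 = 1 / l3\<close>; \<open>Y s $ 2\<close> gets a factor of degree at
    most one because \<open>Binf\<close> is diagonal.\<close>
  have Cg: "C s * g (q * s) = (l4 * s^2 + d1 * s + d0) * g s + (e1 * s + e0) * Y s $ 2"
    if s: "s \<in> ?L" for s
  proof -
    have sa: "a1 - s \<noteq> 0" "a2 - s \<noteq> 0" using generic(5,6) s poles params by auto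
    have inv: "1 / (1 - s / a1) = a1 / (a1 - s)" "1 / (1 - s / a2) = a2 / (a2 - s)"
      using a0 by (simp_all add: field_simps)
    have C: "C s = l3 * l4 * (a1 - s) * (a2 - s)"
    proof -
      have "C s = l3 * l4 * (s - a1) * (s - a2)" unfolding C_def params(5,6) ..
      then show ?thesis by (simp add: algebra_simps)
    qed
    have gq: "g (q * s) = (1 / l3 + a1 / (a1 - s) * B 1 $ 1 $ 1 + a2 / (a2 - s) * B 2 $ 1 $ 1) * g s
        + (a1 / (a1 - s) * B 1 $ 1 $ 2 + a2 / (a2 - s) * B 2 $ 1 $ 2) * Y s $ 2"
      using Y2[OF s] a0 params(1,3,9) unfolding two_pole_nth matrices(1) B_inf_row1 Y1 poles
      by (simp add: inv)
    show ?thesis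
      unfolding C gq d1_def d0_def e1_def e0_def using sa nonzero(3)
      by (simp add: divide_simps) (simp add: algebra_simps power2_eq_square)
  qed
  \<comment> \<open>Coefficients of the two components of \<open>Y\<close> in \<open>U\<close>, with
    numerators expanded to degree at most two, as \<open>q_lattice_bounded_quotient\<close>
    requires.\<close>
  define R1 where "R1 = (\<lambda>s. ((x * l4 - q^2 * x - q * rq * (h1 + h2) - q * \<mu> * d1) * s^2
      + (q * rq * (h1 + h2) * x + h1 * h2 * q + x * d1 - q * \<mu> * d0) * s
      + (x * d0 - x * h1 * h2 * q)) / ((s - x) * (q * s - x)))"
  define R2 where "R2 = (\<lambda>s. ((- q * \<mu> * e1) * s^2 + (x * e1 - q * \<mu> * e0) * s + x * e0)
      / ((s - x) * (q * s - x)))"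
  have U_eq: "U s = \<mu> * x * (?P (x / q) s * Y s $ 1 * R1 s + ?P (x / q) s * Y s $ 2 * R2 s)"
    if s: "s \<in> ?L" for s
  proof -
    define N where "N = x - q * \<mu> * s"
    define a where "a = s - x"
    define b where "b = q * s - x"
    have ab: "a \<noteq> 0" "b \<noteq> 0" using ne[OF s] by (auto simp: a_def b_def)
    have k1: "k1 s = - N / b"
      unfolding k1_def N_def b_def using ne[OF s] by (simp add: divide_simps) (simp add: algebra_simps)
    have R1: "R1 s = (A (q * s) * a + (l4 * s^2 + d1 * s + d0) * N) / (a * b)"
    proof -
      have \<mu>l4: "\<mu> * l4 = q" using \<mu> nonzero by simp
      have A: "A (q * s) = q^2 * s^2 - q * rq * (h1 + h2) * s + h1 * h2 * q"
        unfolding A_def q(3)[symmetric] by (simp add: algebra_simps power2_eq_square)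
      \<comment> \<open>The expansion carries the cubic term explicitly; its factor
        \<open>q - \<mu> * l4\<close> is zero.\<close>
      have "(x * l4 - q^2 * x - q * rq * (h1 + h2) - q * \<mu> * d1) * s^2
          + (q * rq * (h1 + h2) * x + h1 * h2 * q + x * d1 - q * \<mu> * d0) * s
          + (x * d0 - x * h1 * h2 * q)
          = A (q * s) * a + (l4 * s^2 + d1 * s + d0) * N - q * (q - \<mu> * l4) * s^3"
        unfolding A a_def N_def by algebra
      then show ?thesis by (simp add: R1_def a_def b_def \<mu>l4)
    qed
    have R2: "R2 s = (e1 * s + e0) * N / (a * b)"
      unfolding R2_def N_def a_def b_def by (simp add: algebra_simps power2_eq_square)
    have "U s = \<mu> * x * (?P (x / q) s * A (q * s) / b * g s
        + N / b * ?P (x / q) s / a * (C s * g (q * s)))"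
      unfolding U_def P1[OF s] k1 a_def b_def by simp
    also have "\<dots> = \<mu> * x * (?P (x / q) s * Y s $ 1 * R1 s + ?P (x / q) s * Y s $ 2 * R2 s)"
      unfolding Cg[OF s] R1 R2 Y1 using ab by (simp add: field_simps)
    finally show ?thesis .
  qed
  have "(\<lambda>n::int. norm (U (q powi n * \<xi>))) summable_on UNIV"
  proof -
    obtain K1 where K1: "\<And>s. s \<in> ?L \<Longrightarrow> norm (R1 s) \<le> K1"
      unfolding R1_def using q_lattice_bounded_quotient[OF q0 q(2) \<xi> nz[OF x] off[OF x]] by blast
    obtain K2 where K2: "\<And>s. s \<in> ?L \<Longrightarrow> norm (R2 s) \<le> K2"
      unfolding R2_def using q_lattice_bounded_quotient[OF q0 q(2) \<xi> nz[OF x] off[OF x]] by blast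
    let ?F = "\<lambda>s. ?P (x / q) s * Y s $ 1 * R1 s" and ?H = "\<lambda>s. ?P (x / q) s * Y s $ 2 * R2 s"
    have F: "(\<lambda>n::int. norm (?F (q powi n * \<xi>))) summable_on UNIV"
      by (rule q_lattice_abs_summable_mult[OF sum_Y K1])
    have H: "(\<lambda>n::int. norm (?H (q powi n * \<xi>))) summable_on UNIV"
      by (rule q_lattice_abs_summable_mult[OF sum_Y K2])
    show ?thesis
    proof (rule Infinite_Sum.abs_summable_on_comparison_test')
      show "(\<lambda>n::int. norm (\<mu> * x) * (norm (?F (q powi n * \<xi>)) + norm (?H (q powi n * \<xi>))))
          summable_on UNIV"
        by (intro summable_on_cmult_right summable_on_add F H)
      fix n :: int
      have on: "q powi n * \<xi> \<in> ?L" by (auto simp: q_lattice_def)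
      show "norm (U (q powi n * \<xi>))
          \<le> norm (\<mu> * x) * (norm (?F (q powi n * \<xi>)) + norm (?H (q powi n * \<xi>)))"
        unfolding U_eq[OF on] norm_mult[of "\<mu> * x"] by (intro mult_left_mono norm_triangle_ineq) auto
    qed
  qed
  then have "jackson q \<xi> f = 0" using q0 step by (intro jackson_telescope)
  \<comment> \<open>The integrals at \<open>x / q\<close>, \<open>q * x\<close> and \<open>x\<close>
    all converge absolutely, as these points lie in \<open>D\<close>; they merge into one.\<close>
  moreover have "q_heun q rq l1' l2' l3' l4' h1' h2' S' r' E (g_check q lam \<xi> g) x = jackson q \<xi> f"
    unfolding q_heun_def c1_def[symmetric] c2_def[symmetric] c3_def[symmetric] g_check_def f_def
    by (rule jackson_linear) (use conv(2) x xD in auto)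
  ultimately show "q_heun q rq l1' l2' l3' l4' h1' h2' S' r' E (g_check q lam \<xi> g) x = 0"
    by simp
qed

end
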